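(* Let $0<\gamma<1$, $0<\alpha<1$, $x_A>0$, and let $T=(x_T,y_T)$ be a point lying inside the $DA$ Apollonius circle (the circle with center $(a,0)$ and radius $r_A$, $a=\frac{1+\gamma^2}{1-\gamma^2}x_A$, $r_A=\frac{2\gamma}{1-\gamma^2}x_A$). The optimal interception point $I=(x_I,y_I)$, i.e. the point of the $DA$ Apollonius circle that maximizes $$J(x_I,y_I)=\alpha\sqrt{(x_A-x_I)^2+y_I^2}-\sqrt{(x_I-x_T)^2+(y_I-y_T)^2}$$ subject to $(a-x_I)^2+y_I^2=r_A^2$, has polar coordinates $I=(\varphi^*,r_A)$ (angle, radius) with respect to the center of the $DA$ Apollonius circle, where $\varphi^*$ is the solution of the sixth order complex exponential equation \begin{align*} &\frac{Nr_A}{l}\Big(1-\frac{N}{\alpha^2Ml}\Big)e^{6i\varphi} +\Big(\Big(\frac{N}{\alpha Ml}\Big)^2(r_A^2+M^2)-r_A^2-N^2\Big)e^{5i\varphi}\\ &+Nr_A\Big(\frac{N}{\alpha^2Ml^2}(2l^2-1)+l-\frac{2}{l}\Big)e^{4i\varphi} +2\Big(r_A^2+N^2-\Big(\frac{N}{\alpha M}\Big)^2(r_A^2+M^2)\Big)e^{3i\varphi}\\ &+Nr_A\Big(\frac{N}{\alpha^2M}(2-l^2)-2l+\frac{1}{l}\Big)e^{2i\varphi} +\Big(\Big(\frac{Nl}{\alpha M}\Big)^2(r_A^2+M^2)-r_A^2-N^2\Big)e^{i\varphi}\\ &+Nr_Al\Big(1-\frac{Nl}{\alpha^2M}\Big)=0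 \end{align*} that maximizes the cost $$J(\varphi)=\alpha\sqrt{r_A^2+M^2-2Mr_A\cos\varphi}-\sqrt{r_A^2+N^2-2Nr_A\cos(\varphi-\lambda)},$$ where $l=e^{i\lambda}$, $M=\frac{2\gamma^2}{1-\gamma^2}x_A$ is the distance between the points $A=(x_A,0)$ and $(a,0)$, and $N=\sqrt{(a-x_T)^2+y_T^2}$ is the distance between the points $(a,0)$ and $T$.
   Context: Planar pursuit-evasion setting: a Target $T$, an Attacker $A$ and a Defender $D$ move with constant speeds $V_T,V_A,V_D$; $\alpha=V_T/V_A\in(0,1)$ and $\gamma=V_A/V_D\in(0,1)$. In a Cartesian frame their initial positions are $T=(x_T,y_T)$, $A=(x_A,0)$, $D=(-x_A,0)$ with $x_A>0$. The $DA$ Apollonius circle is the set of points $P$ with $|PA|=\gamma|PD|$, i.e. the circle with center $(a,0)$ and radius $r_A$, where $a=\frac{1+\gamma^2}{1-\gamma^2}x_A$ and $r_A=\frac{2\gamma}{1-\gamma^2}x_A$. The Defender intercepts the Attacker at a point $I$ of this circle. The center $(a,0)$ is also denoted by $a$. Polar angle convention: angles at the center $(a,0)$ are measured from the ray going from $(a,0)$ towards $A$ (the negative $X$-direction), with positive angles towards positive $y$. Thus the point with polar coordinates $(\varphi,r_A)$ is $I=(a-r_A\cos\varphi,\ r_A\sin\varphi)$, and $\lambda$ is the polar angle of the Target, i.e. $T=(a-N\cos\lambda,\ N\sin\lambda)$. The angle $\varphi$ is real. *)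

theory Defs
  imports "HOL-Analysis.Analysis"
begin

text \<open>
  The Attacker starts at \<open>(xA, 0)\<close> and the Defender at \<open>(-xA, 0)\<close>; \<open>\<gamma>\<close> is the speed ratio of
  Attacker to Defender and \<open>\<alpha>\<close> that of Target to Attacker. The distance on
  \<^typ>\<open>real \<times> real\<close> is the Euclidean one.
\<close>

definition apollonius_circle :: "real \<Rightarrow> real \<Rightarrow> (real \<times> real) set" where
  "apollonius_circle \<gamma> xA = {P. dist P (xA, 0) = \<gamma> * dist P (- xA, 0)}"

definition center_x :: "real \<Rightarrow> real \<Rightarrow> real" where
  "center_x \<gamma> xA = (1 + \<gamma>\<^sup>2) / (1 - \<gamma>\<^sup>2) * xA"

definition radius :: "real \<Rightarrow> real \<Rightarrow> real" where
  "radius \<gamma> xA = 2 * \<gamma> / (1 - \<gamma>\<^sup>2) * xA"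

lemma apollonius_circle_iff:
  assumes "0 < \<gamma>" "\<gamma> < 1" "0 < xA"
  shows "(x, y) \<in> apollonius_circle \<gamma> xA \<longleftrightarrow>
    (center_x \<gamma> xA - x)\<^sup>2 + y\<^sup>2 = (radius \<gamma> xA)\<^sup>2"
proof -
  have g2: "1 - \<gamma>\<^sup>2 > 0"
    using assms by (simp add: power_less_one_iff abs_square_less_1)
  define a where "a = center_x \<gamma> xA"
  define r where "r = radius \<gamma> xA"
  have a: "(1 - \<gamma>\<^sup>2) * a = (1 + \<gamma>\<^sup>2) * xA"
    using g2 by (simp add: a_def center_x_def)
  have r: "(1 - \<gamma>\<^sup>2) * r = 2 * \<gamma> * xA"
    using g2 by (simp add: r_def radius_def)
  have "(1 - \<gamma>\<^sup>2) * ((1 - \<gamma>\<^sup>2) * (a\<^sup>2 - r\<^sup>2)) =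
      ((1 - \<gamma>\<^sup>2) * a)\<^sup>2 - ((1 - \<gamma>\<^sup>2) * r)\<^sup>2"
    by algebra
  also have "\<dots> = (1 - \<gamma>\<^sup>2) * ((1 - \<gamma>\<^sup>2) * xA\<^sup>2)"
    unfolding a r by algebra
  finally have ar: "a\<^sup>2 - r\<^sup>2 = xA\<^sup>2"
    using g2 by simp
  have "(x, y) \<in> apollonius_circle \<gamma> xA \<longleftrightarrow>
      sqrt ((x - xA)\<^sup>2 + y\<^sup>2) = \<gamma> * sqrt ((x + xA)\<^sup>2 + y\<^sup>2)"
    by (simp add: apollonius_circle_def dist_prod_def dist_real_def)
  also have "\<dots> \<longleftrightarrow> sqrt ((x - xA)\<^sup>2 + y\<^sup>2) = sqrt (\<gamma>\<^sup>2 * ((x + xA)\<^sup>2 + y\<^sup>2))"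
    using assms by (simp add: real_sqrt_mult)
  also have "\<dots> \<longleftrightarrow> (x - xA)\<^sup>2 + y\<^sup>2 = \<gamma>\<^sup>2 * ((x + xA)\<^sup>2 + y\<^sup>2)"
    by simp
  also have "\<dots> \<longleftrightarrow> (1 - \<gamma>\<^sup>2) * ((a - x)\<^sup>2 + y\<^sup>2 - r\<^sup>2) = 0"
  proof -
    have "(1 - \<gamma>\<^sup>2) * ((a - x)\<^sup>2 + y\<^sup>2 - r\<^sup>2) =
        (x - xA)\<^sup>2 + y\<^sup>2 - \<gamma>\<^sup>2 * ((x + xA)\<^sup>2 + y\<^sup>2)"
      using a ar by algebra
    then show ?thesis by simp
  qed
  also have "\<dots> \<longleftrightarrow> (a - x)\<^sup>2 + y\<^sup>2 = r\<^sup>2"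
    using g2 by simp
  finally show ?thesis
    by (simp add: a_def r_def)
qed

definition attacker_dist :: "real \<Rightarrow> real \<Rightarrow> real" where
  "attacker_dist \<gamma> xA = 2 * \<gamma>\<^sup>2 / (1 - \<gamma>\<^sup>2) * xA"

lemma attacker_dist_eq:
  assumes "0 < \<gamma>" "\<gamma> < 1" "0 < xA"
  shows "attacker_dist \<gamma> xA = dist (xA, 0::real) (center_x \<gamma> xA, 0)"
proof -
  have g2: "1 - \<gamma>\<^sup>2 > 0"
    using assms by (simp add: power_less_one_iff abs_square_less_1)
  have "center_x \<gamma> xA - xA = attacker_dist \<gamma> xA"
    using g2 by (simp add: center_x_def attacker_dist_def field_simps)
  moreover have "attacker_dist \<gamma> xA \<ge> 0"
    using g2 assms by (simp add: attacker_dist_def)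
  ultimately show ?thesis
    by (simp add: dist_prod_def dist_real_def abs_minus_commute)
qed

definition target_dist :: "real \<Rightarrow> real \<Rightarrow> real \<Rightarrow> real \<Rightarrow> real" where
  "target_dist \<gamma> xA xT yT = sqrt ((center_x \<gamma> xA - xT)\<^sup>2 + yT\<^sup>2)"

lemma target_dist_eq: "target_dist \<gamma> xA xT yT = dist (center_x \<gamma> xA, 0) (xT, yT)"
  by (simp add: target_dist_def dist_prod_def dist_real_def)

text \<open>
  Polar coordinates with respect to the center \<open>(a, 0)\<close>: angles are measured from the
  negative X-direction (towards the Attacker), positive towards positive \<open>y\<close>.
\<close>

definition polar_point :: "real \<Rightarrow> real \<Rightarrow> real \<Rightarrow> real \<Rightarrow> real \<times> real" where
  "polar_point \<gamma> xA \<phi> \<rho> = (center_x \<gamma> xA - \<rho> * cos \<phi>, \<rho> * sin \<phi>)"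

fun cost :: "real \<Rightarrow> real \<Rightarrow> real \<Rightarrow> real \<Rightarrow> real \<times> real \<Rightarrow> real" where
  "cost \<alpha> xA xT yT (xI, yI) =
     \<alpha> * sqrt ((xA - xI)\<^sup>2 + yI\<^sup>2) - sqrt ((xI - xT)\<^sup>2 + (yI - yT)\<^sup>2)"

definition polar_cost :: "real \<Rightarrow> real \<Rightarrow> real \<Rightarrow> real \<Rightarrow> real \<Rightarrow> real \<Rightarrow> real" where
  "polar_cost \<alpha> r M N \<theta> \<phi> =
     \<alpha> * sqrt (r\<^sup>2 + M\<^sup>2 - 2 * M * r * cos \<phi>)
       - sqrt (r\<^sup>2 + N\<^sup>2 - 2 * N * r * cos (\<phi> - \<theta>))"

text \<open>
  The left-hand side of the exponential equation, with all parameters complex so that the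
  formula needs no embeddings; it is used with real \<open>\<alpha>\<close>, \<open>r\<close>, \<open>M\<close>, \<open>N\<close>, \<open>\<phi>\<close>
  and \<open>l = exp (\<i> \<theta>)\<close>, where \<open>\<theta>\<close> is the polar angle of the Target.
\<close>

definition sextic_lhs ::
    "complex \<Rightarrow> complex \<Rightarrow> complex \<Rightarrow> complex \<Rightarrow> complex \<Rightarrow> complex \<Rightarrow> complex" where
  "sextic_lhs \<alpha> r M N l \<phi> =
     N * r / l * (1 - N / (\<alpha>\<^sup>2 * M * l)) * exp (6 * \<i> * \<phi>)
   + ((N / (\<alpha> * M * l))\<^sup>2 * (r\<^sup>2 + M\<^sup>2) - r\<^sup>2 - N\<^sup>2) * exp (5 * \<i> * \<phi>)
   + N * r * (N / (\<alpha>\<^sup>2 * M * l\<^sup>2) * (2 * l\<^sup>2 - 1) + l - 2 / l) * exp (4 * \<i> * \<phi>)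
   + 2 * (r\<^sup>2 + N\<^sup>2 - (N / (\<alpha> * M))\<^sup>2 * (r\<^sup>2 + M\<^sup>2)) * exp (3 * \<i> * \<phi>)
   + N * r * (N / (\<alpha>\<^sup>2 * M) * (2 - l\<^sup>2) - 2 * l + 1 / l) * exp (2 * \<i> * \<phi>)
   + ((N * l / (\<alpha> * M))\<^sup>2 * (r\<^sup>2 + M\<^sup>2) - r\<^sup>2 - N\<^sup>2) * exp (\<i> * \<phi>)
   + N * r * l * (1 - N * l / (\<alpha>\<^sup>2 * M))"

definition sextic_solution :: "real \<Rightarrow> real \<Rightarrow> real \<Rightarrow> real \<Rightarrow> real \<Rightarrow> real \<Rightarrow> bool" where
  "sextic_solution \<alpha> r M N \<theta> \<phi> \<longleftrightarrow>
     sextic_lhs (of_real \<alpha>) (of_real r) (of_real M) (of_real N) (exp (\<i> * of_real \<theta>)) (of_real \<phi>) = 0"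

end

theory Submission
  imports Defs
begin

text \<open>
  The circle is compact, so the cost has a maximizer on it, and since \<open>M < r\<close> and \<open>N < r\<close> both
  square roots in the polar cost \<open>J\<close> have positive arguments, so \<open>J' = 0\<close> at its angle. Squaring
  the equation \<open>J' = 0\<close> gives
  \<open>(\<alpha> M sin \<phi>)\<^sup>2 (r\<^sup>2 + N\<^sup>2 - 2 N r cos (\<phi> - \<theta>)) = (N sin (\<phi> - \<theta>))\<^sup>2 (r\<^sup>2 + M\<^sup>2 - 2 M r cos \<phi>)\<close>,
  and writing sines and cosines through \<open>e\<^sup>i\<^sup>\<phi>\<close> and multiplying by \<open>e\<^sup>3\<^sup>i\<^sup>\<phi>\<close> turns this into the
  sextic. Squaring may add solutions, but among the solutions the maximizers of \<open>J\<close> are exactly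
  its global maximizers.
\<close>

definition stationarity_defect :: "real \<Rightarrow> real \<Rightarrow> real \<Rightarrow> real \<Rightarrow> real \<Rightarrow> real \<Rightarrow> real" where
  "stationarity_defect \<alpha> r M N \<theta> \<phi> =
     (\<alpha> * M * sin \<phi>)\<^sup>2 * (r\<^sup>2 + N\<^sup>2 - 2 * N * r * cos (\<phi> - \<theta>))
       - (N * sin (\<phi> - \<theta>))\<^sup>2 * (r\<^sup>2 + M\<^sup>2 - 2 * M * r * cos \<phi>)"

text \<open>By \<bar>cos t\<bar> \<le> 1 the expression is at least
  \<open>(r - \<bar>d\<bar>)\<^sup>2\<close>. Positivity keeps both square roots of the polar cost
  differentiable.\<close>

lemma law_of_cosines_pos:
  fixes r d t :: real
  assumes "\<bar>d\<bar> < r"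
  shows "0 < r\<^sup>2 + d\<^sup>2 - 2 * d * r * cos t"
proof -
  have "\<bar>d * cos t\<bar> \<le> \<bar>d\<bar>"
    by (simp add: abs_mult mult_left_le)
  then have "d * cos t * r \<le> \<bar>d\<bar> * r"
    using assms by (intro mult_right_mono) auto
  moreover have "0 < (r - \<bar>d\<bar>)\<^sup>2"
    using assms by simp
  ultimately show ?thesis
    by (simp add: power2_diff algebra_simps)
qed

text \<open>For real angles the bracket is trigonometric: \<open>z - 1 / z\<close> and
  \<open>z / l - l / z\<close> are 2i times a sine, \<open>z + 1 / z\<close> and
  \<open>z / l + l / z\<close> are twice a cosine. The factor \<open>z ^ 3\<close> clears its
  negative powers of \<open>z\<close>, and \<open>\<alpha>\<^sup>2 * M\<^sup>2\<close> clears the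
  denominators \<open>\<alpha>\<close> and \<open>M\<close> of the sextic.\<close>

lemma sextic_lhs_eq_product:
  fixes \<alpha> r M N l z :: complex
  assumes "\<alpha> \<noteq> 0" "M \<noteq> 0" "l \<noteq> 0" and z: "z = exp (\<i> * \<phi>)"
  shows "- (\<alpha>\<^sup>2 * M\<^sup>2) * sextic_lhs \<alpha> r M N l \<phi> =
    z ^ 3 * (\<alpha>\<^sup>2 * M\<^sup>2 * (z - 1 / z)\<^sup>2 * (r\<^sup>2 + N\<^sup>2 - N * r * (z / l + l / z))
      - N\<^sup>2 * (z / l - l / z)\<^sup>2 * (r\<^sup>2 + M\<^sup>2 - M * r * (z + 1 / z)))"
proof -
  have e: "exp (6 * \<i> * \<phi>) = z ^ 6" "exp (5 * \<i> * \<phi>) = z ^ 5" "exp (4 * \<i> * \<phi>) = z ^ 4"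
    "exp (3 * \<i> * \<phi>) = z ^ 3" "exp (2 * \<i> * \<phi>) = z ^ 2"
    by (simp_all add: z mult.assoc flip: exp_of_nat_mult)
  have "z \<noteq> 0"
    by (simp add: z)
  then show ?thesis
    unfolding sextic_lhs_def e z[symmetric] using assms(1-3)
    by (simp add: divide_simps) algebra
qed

text \<open>The two sides differ only by factors that cannot vanish: \<open>\<alpha>\<close>,
  \<open>M\<close> and powers of \<open>z\<close>.\<close>

lemma sextic_solution_iff:
  assumes "\<alpha> \<noteq> 0" "M \<noteq> 0"
  shows "sextic_solution \<alpha> r M N \<theta> \<phi> \<longleftrightarrow> stationarity_defect \<alpha> r M N \<theta> \<phi> = 0"
proof -
  define z where "z = exp (\<i> * complex_of_real \<phi>)"
  define l where "l = exp (\<i> * complex_of_real \<theta>)"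
  have zl: "z \<noteq> 0" "l \<noteq> 0"
    by (simp_all add: z_def l_def)
  have inv: "exp (- (\<i> * complex_of_real \<phi>)) = 1 / z"
    "exp (\<i> * complex_of_real (\<phi> - \<theta>)) = z / l"
    "exp (- (\<i> * complex_of_real (\<phi> - \<theta>))) = l / z"
    by (simp_all add: z_def l_def exp_minus field_simps exp_diff right_diff_distrib)
  have cs: "2 * complex_of_real (cos \<phi>) = z + 1 / z"
    "2 * \<i> * complex_of_real (sin \<phi>) = z - 1 / z"
    "2 * complex_of_real (cos (\<phi> - \<theta>)) = z / l + l / z"
    "2 * \<i> * complex_of_real (sin (\<phi> - \<theta>)) = z / l - l / z"
    unfolding cos_of_real[symmetric] sin_of_real[symmetric] cos_exp_eq sin_exp_eq inv
    by (simp_all add: z_def mult.commute)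
  have sq: "(2 * \<i> * x)\<^sup>2 = - (4 * x\<^sup>2)" for x :: complex
    by (simp add: power_mult_distrib)
  \<comment> \<open>Each term of the product contains one squared sine, and the square of 2i gives
    the constant -4.\<close>
  have "- ((of_real \<alpha>)\<^sup>2 * (of_real M)\<^sup>2) * sextic_lhs \<alpha> r M N l \<phi> =
      - 4 * z ^ 3 * complex_of_real (stationarity_defect \<alpha> r M N \<theta> \<phi>)"
    using sextic_lhs_eq_product[of \<alpha> M l z \<phi> r N, unfolded cs[symmetric] sq] assms zl z_def
    by (simp add: stationarity_defect_def algebra_simps power_mult_distrib)
  then show ?thesis
    using assms zl unfolding sextic_solution_def l_def[symmetric]
    by (metis mult_eq_0_iff neg_equal_0_iff_equal of_real_eq_0_iff power_not_zero zero_neq_numeral)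
qed

lemma stationarity_defect_eq_0:
  assumes "\<bar>M\<bar> < r" "\<bar>N\<bar> < r"
    and max: "\<And>\<psi>. polar_cost \<alpha> r M N \<theta> \<psi> \<le> polar_cost \<alpha> r M N \<theta> \<phi>"
  shows "stationarity_defect \<alpha> r M N \<theta> \<phi> = 0"
proof -
  define A where "A = r\<^sup>2 + M\<^sup>2 - 2 * M * r * cos \<phi>"
  define B where "B = r\<^sup>2 + N\<^sup>2 - 2 * N * r * cos (\<phi> - \<theta>)"
  have pos: "A > 0" "B > 0"
    unfolding A_def B_def by (intro law_of_cosines_pos assms)+
  have "(polar_cost \<alpha> r M N \<theta> has_real_derivative
      \<alpha> * (M * r * sin \<phi> / sqrt A) - N * r * sin (\<phi> - \<theta>) / sqrt B) (at \<phi>)"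
    unfolding polar_cost_def A_def B_def
    using pos[unfolded A_def B_def]
    by (auto intro!: derivative_eq_intros simp: field_simps)
  \<comment> \<open>The neighbourhood radius 1 is arbitrary, as \<phi> is a global
    maximizer.\<close>
  then have "\<alpha> * (M * r * sin \<phi> / sqrt A) - N * r * sin (\<phi> - \<theta>) / sqrt B = 0"
    by (rule DERIV_local_max[of _ _ _ 1]) (auto simp: max)
  \<comment> \<open>Needed to cancel the common factor \<open>r\<close> of both terms of the
    derivative.\<close>
  moreover have "r > 0"
    using assms(1) by linarith
  ultimately have "\<alpha> * M * sin \<phi> * sqrt B = N * sin (\<phi> - \<theta>) * sqrt A"
    using pos by (simp add: field_simps)
  then have "(\<alpha> * M * sin \<phi> * sqrt B)\<^sup>2 = (N * sin (\<phi> - \<theta>) * sqrt A)\<^sup>2"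
    by simp
  then have "(\<alpha> * M * sin \<phi>)\<^sup>2 * B = (N * sin (\<phi> - \<theta>))\<^sup>2 * A"
    using pos by (simp add: power_mult_distrib)
  then show ?thesis
    by (simp add: stationarity_defect_def A_def B_def)
qed

lemma center_x_minus_attacker_dist:
  assumes "0 < \<gamma>" "\<gamma> < 1"
  shows "center_x \<gamma> xA - attacker_dist \<gamma> xA = xA"
proof -
  have "1 - \<gamma>\<^sup>2 \<noteq> 0"
    using assms by (simp add: power2_eq_1_iff)
  then show ?thesis
    by (simp add: center_x_def attacker_dist_def flip: left_diff_distrib diff_divide_distrib)
qed

text \<open>Law of cosines in the two triangles formed by the center, the interception point and
  either the Attacker (polar angle 0, distance \<open>M\<close>) or the Target (polar angle
  \<theta>, distance \<open>N\<close>).\<close>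

lemma cost_polar_point:
  assumes "0 < \<gamma>" "\<gamma> < 1" and T: "(xT, yT) = polar_point \<gamma> xA \<theta> N"
  shows "cost \<alpha> xA xT yT (polar_point \<gamma> xA \<phi> r) =
    polar_cost \<alpha> r (attacker_dist \<gamma> xA) N \<theta> \<phi>"
proof -
  define a where "a = center_x \<gamma> xA"
  define M where "M = attacker_dist \<gamma> xA"
  have xA: "xA = a - M"
    using center_x_minus_attacker_dist[OF assms(1,2), of xA] by (simp add: a_def M_def)
  have xy: "xT = a - N * cos \<theta>" "yT = N * sin \<theta>"
    using T by (simp_all add: polar_point_def a_def)
  have p: "(sin t)\<^sup>2 = 1 - (cos t)\<^sup>2" for t :: real
    by (simp add: sin_squared_eq)
  have "(xA - (a - r * cos \<phi>))\<^sup>2 + (r * sin \<phi>)\<^sup>2 = r\<^sup>2 + M\<^sup>2 - 2 * M * r * cos \<phi>"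
    unfolding xA power_mult_distrib p by algebra
  moreover have "(a - r * cos \<phi> - xT)\<^sup>2 + (r * sin \<phi> - yT)\<^sup>2 =
      r\<^sup>2 + N\<^sup>2 - 2 * N * r * cos (\<phi> - \<theta>)"
    unfolding xy cos_diff using p[of \<phi>] p[of \<theta>] by algebra
  ultimately show ?thesis
    by (simp add: polar_point_def polar_cost_def a_def M_def)
qed

lemma polar_point_in_apollonius_circle:
  assumes "0 < \<gamma>" "\<gamma> < 1" "0 < xA"
  shows "polar_point \<gamma> xA \<phi> (radius \<gamma> xA) \<in> apollonius_circle \<gamma> xA"
  by (simp add: polar_point_def apollonius_circle_iff[OF assms] power_mult_distrib
      flip: distrib_left)

text \<open>Parametrizing over a compact interval yields compactness of the circle as well as an
  angle for each of its points.\<close>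

lemma apollonius_circle_eq_image:
  assumes "0 < \<gamma>" "\<gamma> < 1" "0 < xA"
  shows "apollonius_circle \<gamma> xA = (\<lambda>\<phi>. polar_point \<gamma> xA \<phi> (radius \<gamma> xA)) ` {0..2 * pi}"
proof (intro equalityI subsetI)
  fix P assume P: "P \<in> apollonius_circle \<gamma> xA"
  obtain x y where xy: "P = (x, y)" by force
  define a where "a = center_x \<gamma> xA"
  define r where "r = radius \<gamma> xA"
  have "1 - \<gamma>\<^sup>2 > 0"
    using assms by (simp add: power_less_one_iff)
  then have r: "r > 0"
    using assms by (simp add: r_def radius_def)
  have "(a - x)\<^sup>2 + y\<^sup>2 = r\<^sup>2"
    using P apollonius_circle_iff[OF assms] by (simp add: xy a_def r_def)
  then have "((a - x) / r)\<^sup>2 + (y / r)\<^sup>2 = 1"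
    using r by (simp add: power_divide flip: add_divide_distrib)
  then obtain t where t: "0 \<le> t" "t \<le> 2 * pi" "(a - x) / r = cos t" "y / r = sin t"
    using sincos_total_2pi_le by metis
  then have "x = a - r * cos t" "y = r * sin t"
    using r by (simp_all add: field_simps)
  then have "P = polar_point \<gamma> xA t r"
    by (simp add: xy polar_point_def a_def)
  then show "P \<in> (\<lambda>\<phi>. polar_point \<gamma> xA \<phi> (radius \<gamma> xA)) ` {0..2 * pi}"
    using t by (auto simp: r_def)
next
  fix P assume "P \<in> (\<lambda>\<phi>. polar_point \<gamma> xA \<phi> (radius \<gamma> xA)) ` {0..2 * pi}"
  then show "P \<in> apollonius_circle \<gamma> xA"
    using polar_point_in_apollonius_circle[OF assms] by blast
qed

lemma ex_cost_arg_max: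
  assumes "0 < \<gamma>" "\<gamma> < 1" "0 < xA"
  shows "\<exists>I. is_arg_max (cost \<alpha> xA xT yT) (\<lambda>P. P \<in> apollonius_circle \<gamma> xA) I"
proof -
  have "compact (apollonius_circle \<gamma> xA)"
    unfolding apollonius_circle_eq_image[OF assms] polar_point_def
    by (intro compact_continuous_image continuous_intros) simp
  moreover have "apollonius_circle \<gamma> xA \<noteq> {}"
    using polar_point_in_apollonius_circle[OF assms] by blast
  \<comment> \<open>\<open>cost\<close> is defined by matching on a pair; the form with
    \<open>fst\<close> and \<open>snd\<close> is open to the continuity rules.\<close>
  moreover have "cost \<alpha> xA xT yT = (\<lambda>P. \<alpha> * sqrt ((xA - fst P)\<^sup>2 + (snd P)\<^sup>2)
      - sqrt ((fst P - xT)\<^sup>2 + (snd P - yT)\<^sup>2))"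
    by (auto simp: fun_eq_iff)
  then have "continuous_on (apollonius_circle \<gamma> xA) (cost \<alpha> xA xT yT)"
    by (simp only:) (intro continuous_intros)
  ultimately obtain I where "I \<in> apollonius_circle \<gamma> xA"
    "\<forall>P\<in>apollonius_circle \<gamma> xA. cost \<alpha> xA xT yT P \<le> cost \<alpha> xA xT yT I"
    using continuous_attains_sup by blast
  then show ?thesis
    unfolding is_arg_max_linorder by blast
qed

theorem theorem2:
  fixes \<alpha> \<gamma> xA xT yT \<theta> r M N :: real
  assumes "0 < \<gamma>" "\<gamma> < 1"
    and "0 < \<alpha>" "\<alpha> < 1"
    and "0 < xA"
    and "r = radius \<gamma> xA"
    and "M = attacker_dist \<gamma> xA"
    and "N = target_dist \<gamma> xA xT yT"
    and "(xT, yT) \<in> ball (center_x \<gamma> xA, 0) r"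
    and "(xT, yT) = polar_point \<gamma> xA \<theta> N"
  shows "(\<exists>I. is_arg_max (cost \<alpha> xA xT yT) (\<lambda>P. P \<in> apollonius_circle \<gamma> xA) I) \<and>
    (\<forall>I. is_arg_max (cost \<alpha> xA xT yT) (\<lambda>P. P \<in> apollonius_circle \<gamma> xA) I \<longleftrightarrow>
      (\<exists>\<phi>. I = polar_point \<gamma> xA \<phi> r \<and>
        is_arg_max (polar_cost \<alpha> r M N \<theta>) (sextic_solution \<alpha> r M N \<theta>) \<phi>))"
proof -
  let ?J = "polar_cost \<alpha> r M N \<theta>"
  let ?S = "sextic_solution \<alpha> r M N \<theta>"
  let ?p = "\<lambda>\<phi>. polar_point \<gamma> xA \<phi> r"
  let ?C = "\<lambda>P. P \<in> apollonius_circle \<gamma> xA"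
  have g: "1 - \<gamma>\<^sup>2 > 0"
    using assms(1,2) by (simp add: power_less_one_iff)
  then have M: "M > 0"
    using assms by (simp add: attacker_dist_def)
  \<comment> \<open>With \<gamma> < 1 this places the Attacker strictly inside the circle.\<close>
  moreover have "M = \<gamma> * r"
    unfolding assms(6,7) attacker_dist_def radius_def by (simp add: power2_eq_square)
  moreover have "r > 0"
    using g assms by (simp add: radius_def)
  ultimately have Mr: "\<bar>M\<bar> < r"
    using assms(2) by simp
  have Nr: "\<bar>N\<bar> < r"
    using assms(8,9) by (simp add: target_dist_eq)
  have J: "cost \<alpha> xA xT yT (?p \<phi>) = ?J \<phi>" for \<phi>
    using cost_polar_point[OF assms(1,2,10)] assms(7) by simp
  have circle: "?C (?p \<phi>)" for \<phi>
    using polar_point_in_apollonius_circle assms by simp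
  have circleE: "\<exists>\<phi>. P = ?p \<phi>" if "?C P" for P
    using that apollonius_circle_eq_image[OF assms(1,2,5)] assms(6) by auto
  \<comment> \<open>Angles range over all reals, so maximizing over the circle becomes unconstrained
    maximization of \<open>?J\<close>.\<close>
  have max_iff: "is_arg_max (cost \<alpha> xA xT yT) ?C (?p \<phi>) \<longleftrightarrow> (\<forall>\<psi>. ?J \<psi> \<le> ?J \<phi>)" for \<phi>
    unfolding is_arg_max_linorder using J circle circleE by metis
  have max_sextic: "?S \<phi>" if "\<forall>\<psi>. ?J \<psi> \<le> ?J \<phi>" for \<phi>
    using stationarity_defect_eq_0[OF Mr Nr] that sextic_solution_iff[of \<alpha> M] assms(3) M by simp
  obtain I\<^sub>0 where I0: "is_arg_max (cost \<alpha> xA xT yT) ?C I\<^sub>0"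
    using ex_cost_arg_max[OF assms(1,2,5)] by blast
  then obtain \<phi>\<^sub>0 where "I\<^sub>0 = ?p \<phi>\<^sub>0"
    using circleE[of I\<^sub>0] unfolding is_arg_max_linorder by blast
  then have max0: "\<forall>\<psi>. ?J \<psi> \<le> ?J \<phi>\<^sub>0"
    using I0 max_iff by simp
  \<comment> \<open>The global maximizer \<open>\<phi>\<^sub>0\<close> is itself a solution, so a
    best solution attains at least its value and is global too, whatever solutions squaring has
    added.\<close>
  have "is_arg_max ?J ?S \<phi> \<longleftrightarrow> (\<forall>\<psi>. ?J \<psi> \<le> ?J \<phi>)" for \<phi>
    unfolding is_arg_max_linorder using max0 max_sextic order_trans by metis
  then have "is_arg_max (cost \<alpha> xA xT yT) ?C I \<longleftrightarrow> (\<exists>\<phi>. I = ?p \<phi> \<and> is_arg_max ?J ?S \<phi>)" for I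
    using max_iff circleE by (metis is_arg_max_linorder)
  then show ?thesis
    using I0 by blast
qed

end
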